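(* Let $X(t)$, $t\in\mathbb{R}^d$, be a stochastically continuous, jointly measurable and separable real-valued random process, let $\mathscr{A}\subset\mathbb{R}^d$ be open, and let $f:\mathbb{R}\to\mathbb{R}$ be a measurable function. Let $z\in\mathbb{R}$ and $\kappa\in[-\infty,z]$ be given. Put $$\mathcal{M}(\mathscr{A},X)=\sup_{t\in\mathscr{A}}X(t),\qquad f_\kappa(x)=f(x)\,\mathbb{I}(x>\kappa),\ x\in\mathbb{R},\qquad \mathcal{L}(\mathscr{A},f_\kappa(X))=\int_{\mathscr{A}}f_\kappa(X(t))\,\lambda(dt).$$ If $f(x)>0$ for all $x>\kappa$ and $\mathbb{P}\{\mathcal{M}(\mathscr{A},X)>z\}>0$, then $$\mathbb{P}\{\mathcal{M}(\mathscr{A},X)>z,\ \mathcal{L}(\mathscr{A},f_\kappa(X))=0\}=0.$$ If, in addition, $\mathcal{L}(\mathscr{A},f_\kappa(X))$ is almost surely finite, then $$\mathbb{P}\{\mathcal{M}(\mathscr{A},X)>z\}=\int_{\mathscr{A}}\mathbb{E}\left\{\frac{f_\kappa(X(t))\,\mathbb{I}(\mathcal{M}(\mathscr{A},X)>z)}{\mathcal{L}(\mathscr{A},f_\kappa(X))}\right\}\lambda(dt).$$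
   Context: $\lambda$ is Lebesgue measure on $\mathbb{R}^d$ and $\mathbb{I}(\cdot)$ is the indicator function. Stochastic continuity means that for every $t\in\mathbb{R}^d$, $X(s)\to X(t)$ in probability as $s\to t$. Joint measurability means that $(\omega,t)\mapsto X(t)(\omega)$ is jointly measurable. Separability means that there are a countable dense set $D\subset\mathbb{R}^d$ (a separant) and a null event $N$ such that for every open $G\subset\mathbb{R}^d$ and every closed $F\subset\mathbb{R}$ the sets $\{X(t)\in F\ \forall t\in G\cap D\}$ and $\{X(t)\in F\ \forall t\in G\}$ differ only by a subset of $N$; in particular $\sup_{t\in\mathscr{A}}X(t)=\sup_{t\in\mathscr{A}\cap D}X(t)$ almost surely for open $\mathscr{A}$. The supremum may take the value $+\infty$, the integral $\mathcal{L}(\mathscr{A},f_\kappa(X))$ of a nonnegative function takes values in $[0,\infty]$, and $\frac{0}{0}$ is interpreted as $0$. *)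

theory Defs
  imports "HOL-Probability.Probability"
begin

text \<open>A process is a map X of time and outcome; time ranges over a Euclidean space.\<close>

definition jointly_measurable :: "'w measure \<Rightarrow> ('a::euclidean_space \<Rightarrow> 'w \<Rightarrow> real) \<Rightarrow> bool" where
  "jointly_measurable M X \<longleftrightarrow> (\<lambda>(\<omega>, t). X t \<omega>) \<in> borel_measurable (M \<Otimes>\<^sub>M borel)"

text \<open>The events below are measurable whenever each X t is a random variable, which
  \<^const>\<open>jointly_measurable\<close> implies.\<close>

definition stochastically_continuous ::
    "'w measure \<Rightarrow> ('a::euclidean_space \<Rightarrow> 'w \<Rightarrow> real) \<Rightarrow> bool" where
  "stochastically_continuous M X \<longleftrightarrow>
     (\<forall>t. \<forall>\<epsilon>>0. ((\<lambda>s. measure M {\<omega> \<in> space M. \<bar>X s \<omega> - X t \<omega>\<bar> > \<epsilon>}) \<longlongrightarrow> 0) (at t))"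

definition separable_process ::
    "'w measure \<Rightarrow> ('a::euclidean_space \<Rightarrow> 'w \<Rightarrow> real) \<Rightarrow> bool" where
  "separable_process M X \<longleftrightarrow>
     (\<exists>D N. countable D \<and> closure D = UNIV \<and> N \<in> null_sets M \<and>
        (\<forall>G F. open G \<longrightarrow> closed F \<longrightarrow>
           sym_diff {\<omega> \<in> space M. \<forall>t\<in>G \<inter> D. X t \<omega> \<in> F} {\<omega> \<in> space M. \<forall>t\<in>G. X t \<omega> \<in> F} \<subseteq> N))"

definition sup_functional :: "'a set \<Rightarrow> ('a \<Rightarrow> real) \<Rightarrow> ereal" where
  "sup_functional A x = (SUP t\<in>A. ereal (x t))"

definition cut_above :: "ereal \<Rightarrow> (real \<Rightarrow> real) \<Rightarrow> real \<Rightarrow> real" where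
  "cut_above \<kappa> f x = f x * indicator {y. ereal y > \<kappa>} x"

text \<open>Meant for nonnegative g only: \<^const>\<open>ennreal\<close> truncates negative values to 0.\<close>

definition integral_functional ::
    "'a::euclidean_space set \<Rightarrow> (real \<Rightarrow> real) \<Rightarrow> ('a \<Rightarrow> real) \<Rightarrow> ennreal" where
  "integral_functional A g x = (\<integral>\<^sup>+t\<in>A. ennreal (g (x t)) \<partial>lborel)"

end

theory Submission
  imports Defs
begin

text \<open>By Fubini, for almost every \<^term>\<open>s\<close> in the open set the value at \<^term>\<open>s\<close> is almost surely
  at most \<^term>\<open>z\<close> on the event that the integral vanishes. Every point \<^term>\<open>t\<close> is a limit of such
  \<^term>\<open>s\<close>, so stochastic continuity carries the bound over to \<^term>\<open>t\<close>, and separability carries it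
  from the separant to the supremum. Hence the integral is positive almost surely when the supremum
  exceeds \<^term>\<open>z\<close>, and the formula follows by exchanging the two integrals.\<close>

lemma cut_above_measurable [measurable]:
  assumes [measurable]: "f \<in> borel_measurable borel"
  shows "cut_above \<kappa> f \<in> borel_measurable borel"
  unfolding cut_above_def[abs_def] by measurable

lemma less_sup_functional_iff: "ereal z < sup_functional A x \<longleftrightarrow> (\<exists>t\<in>A. z < x t)"
  by (simp add: sup_functional_def less_SUP_iff)

text \<open>Joint measurability is assumed over \<open>borel\<close>, whereas Fubini runs over
  \<open>lborel\<close>; the two have the same sets.\<close>

lemma measurable_process:
  fixes X :: "'a::euclidean_space \<Rightarrow> 'w \<Rightarrow> real"
  assumes "jointly_measurable M X"
  shows "(\<lambda>p. X (snd p) (fst p)) \<in> borel_measurable (M \<Otimes>\<^sub>M lborel)"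
    and "X t \<in> borel_measurable M"
proof -
  have *: "(\<lambda>(\<omega>, t). X t \<omega>) \<in> borel_measurable (M \<Otimes>\<^sub>M borel)"
    using assms by (simp add: jointly_measurable_def)
  moreover have "sets (M \<Otimes>\<^sub>M borel) = sets (M \<Otimes>\<^sub>M (lborel :: 'a measure))"
    by (intro sets_pair_measure_cong) simp_all
  ultimately show "(\<lambda>p. X (snd p) (fst p)) \<in> borel_measurable (M \<Otimes>\<^sub>M lborel)"
    using measurable_cong_sets by (auto simp: case_prod_beta')
  have "(\<lambda>\<omega>. (\<lambda>(\<omega>, t). X t \<omega>) (\<omega>, t)) \<in> borel_measurable M"
    by (rule measurable_compose[OF _ *]) simp
  then show "X t \<in> borel_measurable M"
    by simp
qed

lemma measurable_integral_functional:
  fixes X :: "'a::euclidean_space \<Rightarrow> 'w \<Rightarrow> real"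
  assumes "jointly_measurable M X" and [measurable]: "A \<in> sets borel" "g \<in> borel_measurable borel"
  shows "(\<lambda>\<omega>. integral_functional A g (\<lambda>t. X t \<omega>)) \<in> borel_measurable M"
proof -
  note [measurable] = measurable_process(1)[OF assms(1)]
  have "(\<lambda>\<omega>. \<integral>\<^sup>+t. ennreal (g (X (snd (\<omega>, t)) (fst (\<omega>, t)))) * indicator A t \<partial>lborel)
    \<in> borel_measurable M"
    by measurable
  then show ?thesis
    by (simp add: integral_functional_def)
qed

text \<open>Separability for \<open>G = A\<close> and \<open>F = {..z}\<close>, complemented. A
  condition on uncountably many times is thereby replaced, off a null set, by one on countably
  many.\<close>

lemma separable_process_separant:
  assumes "separable_process M X" "open A"
  obtains D where "countable D"
    "AE \<omega> in M. ereal z < sup_functional A (\<lambda>t. X t \<omega>) \<longleftrightarrow> (\<exists>t\<in>A \<inter> D. z < X t \<omega>)"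
proof -
  obtain D N where D: "countable D" and N: "N \<in> null_sets M"
    and sep: "\<And>G F. open G \<Longrightarrow> closed F \<Longrightarrow>
      sym_diff {\<omega> \<in> space M. \<forall>t\<in>G \<inter> D. X t \<omega> \<in> F} {\<omega> \<in> space M. \<forall>t\<in>G. X t \<omega> \<in> F} \<subseteq> N"
    using assms(1) by (auto simp: separable_process_def)
  have "AE \<omega> in M. ereal z < sup_functional A (\<lambda>t. X t \<omega>) \<longleftrightarrow> (\<exists>t\<in>A \<inter> D. z < X t \<omega>)"
    using AE_not_in[OF N] AE_space
  proof eventually_elim
    case (elim \<omega>)
    then have "(\<forall>t\<in>A \<inter> D. X t \<omega> \<le> z) \<longleftrightarrow> (\<forall>t\<in>A. X t \<omega> \<le> z)"
      using sep[OF assms(2) closed_atMost, of z] unfolding atMost_iff by blast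
    then show ?case
      unfolding less_sup_functional_iff by (meson not_le)
  qed
  with D show thesis
    by (rule that)
qed

text \<open>If \<open>P\<close> failed throughout a punctured neighbourhood of \<open>t\<close>,
  that neighbourhood would meet \<open>A\<close> in a null set, yet a nonempty open set has positive
  measure.\<close>

lemma frequently_at_AE_lborel:
  fixes t :: "'a::euclidean_space"
  assumes "AE s in lborel. s \<in> A \<longrightarrow> P s" "open A" "t \<in> A"
  shows "\<exists>\<^sub>F s in at t. P s"
  unfolding frequently_def
proof
  assume "\<forall>\<^sub>F s in at t. \<not> P s"
  then obtain U where U: "open U" "t \<in> U" "\<And>s. s \<in> U \<Longrightarrow> s \<noteq> t \<Longrightarrow> \<not> P s"
    by (auto simp: eventually_at_topological)
  \<comment> \<open>\<open>U\<close> says nothing about \<open>P\<close> at \<open>t\<close> itself,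
    so \<open>{t}\<close> is discarded as a null set.\<close>
  have "AE s in lborel. s \<notin> A \<inter> U"
    using assms(1) AE_lborel_singleton[of t] by eventually_elim (use U in auto)
  then have "A \<inter> U \<in> null_sets lborel"
    using U(1) assms(2) by (simp add: AE_iff_null_sets open_Int)
  then have "negligible (A \<inter> U)"
    by (simp add: negligible_iff_null_sets null_sets_completionI)
  moreover have "open (A \<inter> U)" "A \<inter> U \<noteq> {}"
    using U assms by auto
  ultimately show False
    using open_not_negligible by blast
qed

text \<open>Where \<open>X t\<close> exceeds \<open>z + e\<close> while \<open>X s\<close> is at
  most \<open>z\<close>, the two differ by more than \<open>e\<close>, which has small probability
  for \<open>s\<close> near \<open>t\<close>. Frequently many good \<open>s\<close> suffice, because
  a frequent and an eventual property share a point.\<close>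

lemma AE_le_of_frequently_AE_le:
  assumes "prob_space M" "stochastically_continuous M X" "\<And>t. X t \<in> borel_measurable M"
    and B: "B \<in> sets M" and freq: "\<exists>\<^sub>F s in at t. AE \<omega> in M. \<omega> \<in> B \<longrightarrow> X s \<omega> \<le> z"
  shows "AE \<omega> in M. \<omega> \<in> B \<longrightarrow> X t \<omega> \<le> z"
proof -
  interpret prob_space M by fact
  note [measurable] = assms(3) B
  have "AE \<omega> in M. \<not> (\<omega> \<in> B \<and> z + e < X t \<omega>)" if "e > 0" for e
  proof -
    let ?C = "{\<omega> \<in> space M. \<omega> \<in> B \<and> z + e < X t \<omega>}"
    have "prob ?C \<le> d" if "d > 0" for d
    proof -
      have "((\<lambda>s. prob {\<omega> \<in> space M. \<bar>X s \<omega> - X t \<omega>\<bar> > e}) \<longlongrightarrow> 0) (at t)"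
        using assms(2) \<open>e > 0\<close> by (simp add: stochastically_continuous_def)
      then have "\<forall>\<^sub>F s in at t. prob {\<omega> \<in> space M. \<bar>X s \<omega> - X t \<omega>\<bar> > e} < d"
        using \<open>d > 0\<close> by (rule order_tendstoD(2))
      from frequently_eventually_frequently[OF freq this]
      obtain s where s: "AE \<omega> in M. \<omega> \<in> B \<longrightarrow> X s \<omega> \<le> z"
        "prob {\<omega> \<in> space M. \<bar>X s \<omega> - X t \<omega>\<bar> > e} < d"
        by (auto dest: frequently_ex)
      have "prob ?C \<le> prob {\<omega> \<in> space M. \<bar>X s \<omega> - X t \<omega>\<bar> > e}"
        by (rule finite_measure_mono_AE) (use s(1) in \<open>eventually_elim, auto\<close>, measurable)
      with s(2) show ?thesis by simp
    qed
    then have "prob ?C = 0"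
      by (meson dense_ge measure_nonneg order_antisym)
    then show ?thesis
      by (subst (asm) prob_eq_0) auto
  qed
  \<comment> \<open>Restricting to the countably many margins \<open>1 / (n + 1)\<close> keeps the
    union of the exceptional sets null; they tend to 0, so the margin disappears.\<close>
  then have "AE \<omega> in M. \<forall>n. \<not> (\<omega> \<in> B \<and> z + 1 / real (Suc n) < X t \<omega>)"
    by (subst AE_all_countable) simp
  then show ?thesis
  proof eventually_elim
    case (elim \<omega>)
    show ?case
    proof (rule impI, rule field_le_epsilon)
      fix e :: real assume "\<omega> \<in> B" "0 < e"
      then obtain n where "1 / real (Suc n) < e"
        using nat_approx_posE by blast
      moreover have "X t \<omega> \<le> z + 1 / real (Suc n)"
        using elim \<open>\<omega> \<in> B\<close> by (auto simp: not_less)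
      ultimately show "X t \<omega> \<le> z + e" by simp
    qed
  qed
qed

lemma AE_integral_functional_nonzero:
  fixes X :: "'a::euclidean_space \<Rightarrow> 'w \<Rightarrow> real"
  assumes "prob_space M" "stochastically_continuous M X" "jointly_measurable M X"
    "separable_process M X" "open A" and [measurable]: "g \<in> borel_measurable borel"
    and pos: "\<And>x. z < x \<Longrightarrow> 0 < g x"
  shows "AE \<omega> in M. ereal z < sup_functional A (\<lambda>t. X t \<omega>) \<longrightarrow>
           integral_functional A g (\<lambda>t. X t \<omega>) \<noteq> 0"
proof -
  interpret prob_space M by fact
  interpret pair_sigma_finite M "lborel :: 'a measure" ..
  have [measurable]: "A \<in> sets borel" using \<open>open A\<close> by simp
  note Xm [measurable] = measurable_process[OF assms(3)]
  \<comment> \<open>Contrapositive of \<open>pos\<close>, in this form because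
    \<open>ennreal (g x) = 0\<close> says only that \<open>g x\<close> is not positive.\<close>
  have le: "x \<le> z" if "g x \<le> 0" for x
    using pos[of x] that by linarith
  define L where "L \<omega> = integral_functional A g (\<lambda>t. X t \<omega>)" for \<omega>
  have [measurable]: "L \<in> borel_measurable M"
    unfolding L_def[abs_def] by (rule measurable_integral_functional) (use assms in auto)
  \<comment> \<open>The zero set of the integral is measurable in \<open>M\<close>. The supremum
    event, possibly not measurable, enters only at the end through \<open>D\<close>.\<close>
  define B where "B = {\<omega> \<in> space M. L \<omega> = 0}"
  have B: "B \<in> sets M" unfolding B_def by measurable
  have "AE \<omega> in M. AE s in lborel. L \<omega> = 0 \<longrightarrow> s \<in> A \<longrightarrow> X s \<omega> \<le> z"
    using AE_space
  proof eventually_elim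
    case (elim \<omega>)
    have [measurable]: "(\<lambda>s. X s \<omega>) \<in> borel_measurable borel"
      using measurable_compose[OF measurable_Pair1'[OF elim] Xm(1)] by simp
    show ?case
    proof (cases "L \<omega> = 0")
      case True
      then have "AE s in lborel. ennreal (g (X s \<omega>)) * indicator A s = 0"
        by (simp add: L_def integral_functional_def nn_integral_0_iff_AE)
      then show ?thesis
        by eventually_elim (auto simp: ennreal_eq_0_iff indicator_def intro: le)
    qed simp
  qed
  \<comment> \<open>Fubini for null sets: a measurable set in the product is null iff almost all its
    sections, in either direction, are null.\<close>
  then have "AE s in lborel. AE \<omega> in M. L \<omega> = 0 \<longrightarrow> s \<in> A \<longrightarrow> X s \<omega> \<le> z"
    by (subst (asm) AE_commute) measurable
  \<comment> \<open>With \<open>s \<in> A\<close> outside the inner quantifier, the inner statement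
    becomes the \<open>P s\<close> of \<open>frequently_at_AE_lborel\<close>.\<close>
  then have ae: "AE s in lborel. s \<in> A \<longrightarrow> (AE \<omega> in M. \<omega> \<in> B \<longrightarrow> X s \<omega> \<le> z)"
    by eventually_elim (auto simp: B_def)
  obtain D where "countable D" and
    D: "AE \<omega> in M. ereal z < sup_functional A (\<lambda>t. X t \<omega>) \<longleftrightarrow> (\<exists>t\<in>A \<inter> D. z < X t \<omega>)"
    by (rule separable_process_separant[OF assms(4,5)])
  have "AE \<omega> in M. \<forall>t\<in>A \<inter> D. \<omega> \<in> B \<longrightarrow> X t \<omega> \<le> z"
    using AE_le_of_frequently_AE_le[OF assms(1,2) Xm(2) B]
      frequently_at_AE_lborel[OF ae \<open>open A\<close>] \<open>countable D\<close>
    by (subst AE_ball_countable) auto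
  then show ?thesis
    using D AE_space
  proof eventually_elim
    case (elim \<omega>)
    then have "\<omega> \<in> B \<Longrightarrow> \<not> ereal z < sup_functional A (\<lambda>t. X t \<omega>)"
      by (meson not_le)
    with elim show ?case
      by (auto simp: B_def L_def)
  qed
qed

theorem theorem2p1:
  fixes M :: "'w measure"
    and X :: "'a::euclidean_space \<Rightarrow> 'w \<Rightarrow> real"
    and A :: "'a set"
    and f :: "real \<Rightarrow> real"
    and z :: real
    and \<kappa> :: ereal
  assumes "prob_space M"
    and "stochastically_continuous M X"
    and "jointly_measurable M X"
    and "separable_process M X"
    and "open A"
    and "f \<in> borel_measurable borel"
    and "\<kappa> \<le> ereal z"
    and "\<And>x. ereal x > \<kappa> \<Longrightarrow> f x > 0"
    and "emeasure (completion M) {\<omega> \<in> space M. sup_functional A (\<lambda>t. X t \<omega>) > ereal z} > 0"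
  shows "{\<omega> \<in> space M. sup_functional A (\<lambda>t. X t \<omega>) > ereal z \<and>
            integral_functional A (cut_above \<kappa> f) (\<lambda>t. X t \<omega>) = 0} \<in> null_sets (completion M) \<and>
         ((AE \<omega> in M. integral_functional A (cut_above \<kappa> f) (\<lambda>t. X t \<omega>) < \<infinity>) \<longrightarrow>
          emeasure (completion M) {\<omega> \<in> space M. sup_functional A (\<lambda>t. X t \<omega>) > ereal z} =
          (\<integral>\<^sup>+t\<in>A. (\<integral>\<^sup>+\<omega>. ennreal (cut_above \<kappa> f (X t \<omega>))
                 * indicator {\<omega>'. sup_functional A (\<lambda>s. X s \<omega>') > ereal z} \<omega>
                 / integral_functional A (cut_above \<kappa> f) (\<lambda>s. X s \<omega>) \<partial>completion M) \<partial>lborel))"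
proof -
  interpret prob_space M by fact
  interpret pair_sigma_finite M "lborel :: 'a measure" ..
  have [measurable]: "A \<in> sets borel" using \<open>open A\<close> by simp
  note Xm [measurable] = measurable_process[OF assms(3)]
  define g where "g = cut_above \<kappa> f"
  have [measurable]: "g \<in> borel_measurable borel"
    unfolding g_def using assms(6) by measurable
  have pos: "0 < g x" if "z < x" for x
  proof -
    have "\<kappa> < ereal x" using assms(7) that by (auto intro: le_less_trans)
    then show ?thesis using assms(8) by (simp add: g_def cut_above_def)
  qed
  \<comment> \<open>\<open>E\<close> may fail to be measurable in \<open>M\<close>, hence the
    passage to \<open>completion M\<close>. Like the indicator in the claim, it is not cut down to
    \<open>space M\<close>.\<close>
  define E where "E = {\<omega>. sup_functional A (\<lambda>t. X t \<omega>) > ereal z}"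
  define L where "L \<omega> = integral_functional A g (\<lambda>t. X t \<omega>)" for \<omega>
  have [measurable]: "L \<in> borel_measurable M"
    unfolding L_def[abs_def] by (rule measurable_integral_functional) (use assms in auto)
  have nz: "AE \<omega> in M. \<omega> \<in> E \<longrightarrow> L \<omega> \<noteq> 0"
    using AE_integral_functional_nonzero[of M X A g z] assms(1-5) pos by (simp add: E_def L_def)
  have "AE \<omega> in completion M. \<not> (\<omega> \<in> E \<and> L \<omega> = 0)"
    using AE_completion[OF nz] by simp
  \<comment> \<open>In a complete measure the exceptional set of an almost sure property is itself
    measurable and null.\<close>
  then have part1: "{\<omega> \<in> space M. \<omega> \<in> E \<and> L \<omega> = 0} \<in> null_sets (completion M)"
    by (simp add: completion.AE_iff_null_sets)
  obtain D where "countable D" and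
    D: "AE \<omega> in M. \<omega> \<in> E \<longleftrightarrow> (\<exists>t\<in>A \<inter> D. z < X t \<omega>)"
    unfolding E_def mem_Collect_eq by (rule separable_process_separant[OF assms(4,5)])
  \<comment> \<open>A version of \<open>E\<close> that is measurable in \<open>M\<close>, being a
    countable union; it replaces \<open>E\<close> in the integrand to which Fubini is
    applied.\<close>
  define S where "S = {\<omega> \<in> space M. \<exists>t\<in>A \<inter> D. z < X t \<omega>}"
  have [measurable]: "S \<in> sets M"
    unfolding S_def using \<open>countable D\<close> by (intro sets.sets_Collect_countable_Ex') auto
  have ES: "AE \<omega> in M. \<omega> \<in> E \<longleftrightarrow> \<omega> \<in> S"
    using D AE_space by eventually_elim (auto simp: S_def)
  have "emeasure (completion M) {\<omega> \<in> space M. \<omega> \<in> E} =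
      (\<integral>\<^sup>+t\<in>A. (\<integral>\<^sup>+\<omega>. ennreal (g (X t \<omega>)) * indicator E \<omega> / L \<omega> \<partial>completion M) \<partial>lborel)"
    if fin: "AE \<omega> in M. L \<omega> < \<infinity>"
  proof -
    \<comment> \<open>Nonnegative integrals over \<open>completion M\<close> and \<open>M\<close>
      agree, and a change of the integrand on a null set does not affect them.\<close>
    have inner: "(\<integral>\<^sup>+\<omega>. ennreal (g (X t \<omega>)) * indicator E \<omega> / L \<omega> \<partial>completion M)
        = (\<integral>\<^sup>+\<omega>. ennreal (g (X t \<omega>)) * indicator S \<omega> / L \<omega> \<partial>M)" for t
      unfolding nn_integral_completion
      by (rule nn_integral_cong_AE) (use ES in \<open>eventually_elim, auto simp: indicator_def\<close>)
    have "(\<integral>\<^sup>+t\<in>A. (\<integral>\<^sup>+\<omega>. ennreal (g (X t \<omega>)) * indicator E \<omega> / L \<omega> \<partial>completion M) \<partial>lborel)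
        = (\<integral>\<^sup>+t. (\<integral>\<^sup>+\<omega>. ennreal (g (X t \<omega>)) * indicator S \<omega> / L \<omega> * indicator A t \<partial>M) \<partial>lborel)"
      unfolding inner by (intro nn_integral_cong nn_integral_multc[symmetric]) measurable
    also have "\<dots> = (\<integral>\<^sup>+\<omega>. (\<integral>\<^sup>+t. ennreal (g (X t \<omega>)) * indicator S \<omega> / L \<omega> * indicator A t \<partial>lborel) \<partial>M)"
      by (rule Fubini') (simp add: case_prod_beta', measurable)
    \<comment> \<open>For fixed \<open>\<omega>\<close> the factor
      \<open>indicator S \<omega> / L \<omega>\<close> does not depend on \<open>t\<close>, and what
      remains integrates to \<open>L \<omega>\<close>.\<close>
    also have "\<dots> = (\<integral>\<^sup>+\<omega>. indicator S \<omega> / L \<omega> * L \<omega> \<partial>M)"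
    proof (rule nn_integral_cong)
      fix \<omega> assume "\<omega> \<in> space M"
      have [measurable]: "(\<lambda>s. X s \<omega>) \<in> borel_measurable borel"
        using measurable_compose[OF measurable_Pair1'[OF \<open>\<omega> \<in> space M\<close>] Xm(1)] by simp
      have "(\<integral>\<^sup>+t. ennreal (g (X t \<omega>)) * indicator S \<omega> / L \<omega> * indicator A t \<partial>lborel)
          = (\<integral>\<^sup>+t. indicator S \<omega> / L \<omega> * (ennreal (g (X t \<omega>)) * indicator A t) \<partial>lborel)"
        by (simp add: divide_ennreal_def mult_ac)
      also have "\<dots> = indicator S \<omega> / L \<omega> * L \<omega>"
        unfolding L_def integral_functional_def by (rule nn_integral_cmult) measurable
      finally show "(\<integral>\<^sup>+t. ennreal (g (X t \<omega>)) * indicator S \<omega> / L \<omega> * indicator A t \<partial>lborel)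
          = indicator S \<omega> / L \<omega> * L \<omega>" .
    qed
    also have "\<dots> = (\<integral>\<^sup>+\<omega>. indicator S \<omega> \<partial>M)"
    proof (rule nn_integral_cong_AE)
      \<comment> \<open>Almost surely on \<open>S\<close>, \<open>nz\<close> and \<open>fin\<close>
        make \<open>L \<omega>\<close> nonzero and finite, so the quotient cancels to 1. Off
        \<open>S\<close> both sides are 0, even if \<open>L \<omega> = 0\<close>, since
        \<open>0 / 0 = 0\<close> in \<open>ennreal\<close>.\<close>
      show "AE \<omega> in M. indicator S \<omega> / L \<omega> * L \<omega> = indicator S \<omega>"
        using nz fin ES
        by eventually_elim (auto simp: indicator_def ennreal_divide_times ennreal_divide_self)
    qed
    also have "\<dots> = emeasure (completion M) S"
      by simp
    also have "\<dots> = emeasure (completion M) {\<omega> \<in> space M. \<omega> \<in> E}"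
    proof (rule emeasure_eq_AE)
      show ae: "AE \<omega> in completion M. \<omega> \<in> S \<longleftrightarrow> \<omega> \<in> {\<omega> \<in> space M. \<omega> \<in> E}"
        by (rule AE_completion) (use ES AE_space in \<open>eventually_elim, auto\<close>)
      show "S \<in> sets (completion M)" by simp
      \<comment> \<open>The completion contains every subset of the space that agrees almost
        everywhere with a measurable set, here \<open>S\<close>.\<close>
      show "{\<omega> \<in> space M. \<omega> \<in> E} \<in> sets (completion M)"
        by (rule completion.in_sets_AE[OF ae]) auto
    qed
    finally show ?thesis by simp
  qed
  with part1 show ?thesis
    by (simp add: E_def L_def g_def)
qed

end
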